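(* Let $n\ge 3$ and let $\{S_i\}_{i=1}^n$ be a family of bounded semilattices, each with $0_{S_i}\neq 1_{S_i}$. Suppose each $S_i$ is a finite chain and let $S=\prod_{i=1}^n S_i$. Then $G(S)$ is Eulerian if and only if either (a) the length $l(S_i)$ is even for all $1\le i\le n$, or (b) each $S_i$ has exactly two elements.
   Context: A bounded semilattice $(S,\cdot,0,1)$ is a commutative semigroup whose operation is idempotent ($x\cdot x=x$ for all $x$), with a neutral element $1$ and an absorbing element $0$; it is partially ordered by $x\le y \iff x\cdot y=x$, so that $0\le x\le 1$. It is a chain if this order is total. The graph $G(S)$ is the simple graph with vertex set $S\setminus\{0,1\}$ in which two vertices $x,y$ are adjacent iff $x\ne y$ and $x\cdot y\neq 0$. The product $\prod_i S_i$ is a bounded semilattice with componentwise operation, $0_S=(0_{S_i})$ and $1_S=(1_{S_i})$. The length of a poset $P$ is $l(P)=\sup\{|C|-1 : C \text{ a chain of } P\}$; in particular a finite chain with $k$ elements has length $k-1$. A graph is Eulerian if it is connected and admits a closed walk traversing each edge exactly once. *)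

theory Defs
  imports
    "HOL-Algebra.Group"
    "HOL-Library.FuncSet"
    "HOL-Library.Extended_Nat"
    "Graph_Theory.Digraph_Component"
    "Graph_Theory.Vertex_Walk"
begin

section \<open>Bounded semilattices\<close>

record 'a bsl = "'a monoid" +
  absorb :: 'a  ("\<zero>\<index>")

locale bounded_semilattice = comm_monoid S for S (structure) +
  assumes idem: "x \<in> carrier S \<Longrightarrow> x \<otimes> x = x"
    and absorb_closed: "\<zero> \<in> carrier S"
    and absorb_mult: "x \<in> carrier S \<Longrightarrow> \<zero> \<otimes> x = \<zero>"

definition sl_le :: "('a, 'b) bsl_scheme \<Rightarrow> 'a \<Rightarrow> 'a \<Rightarrow> bool" where
  "sl_le S x y \<longleftrightarrow> x \<otimes>\<^bsub>S\<^esub> y = x"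

definition is_chain :: "('a, 'b) bsl_scheme \<Rightarrow> bool" where
  "is_chain S \<longleftrightarrow> Complete_Partial_Order.chain (sl_le S) (carrier S)"

definition bsl_prod :: "'i set \<Rightarrow> ('i \<Rightarrow> ('a, 'b) bsl_scheme) \<Rightarrow> ('i \<Rightarrow> 'a) bsl" where
  "bsl_prod I S =
    \<lparr> carrier = (\<Pi>\<^sub>E i\<in>I. carrier (S i)),
      monoid.mult = (\<lambda>x y. \<lambda>i\<in>I. x i \<otimes>\<^bsub>S i\<^esub> y i),
      one = (\<lambda>i\<in>I. \<one>\<^bsub>S i\<^esub>),
      absorb = (\<lambda>i\<in>I. \<zero>\<^bsub>S i\<^esub>) \<rparr>"

lemma bounded_semilattice_bsl_prod:
  assumes "\<And>i. i \<in> I \<Longrightarrow> bounded_semilattice (S i)"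
  shows "bounded_semilattice (bsl_prod I S)"
proof -
  have cm: "Group.comm_monoid (S i)" if "i \<in> I" for i
    using assms[OF that] by (simp add: bounded_semilattice_def)
  have m: "Group.monoid (S i)" if "i \<in> I" for i
    using cm[OF that] by (simp add: Group.comm_monoid_def)
  show ?thesis
  proof (intro bounded_semilattice.intro bounded_semilattice_axioms.intro comm_monoidI)
    fix x assume x: "x \<in> carrier (bsl_prod I S)"
    show "\<one>\<^bsub>bsl_prod I S\<^esub> \<otimes>\<^bsub>bsl_prod I S\<^esub> x = x"
      using x by (auto simp: bsl_prod_def fun_eq_iff PiE_iff extensional_def m monoid.l_one)
    show "x \<otimes>\<^bsub>bsl_prod I S\<^esub> x = x"
      using x assms
      by (auto simp: bsl_prod_def fun_eq_iff PiE_iff extensional_def bounded_semilattice.idem)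
    show "\<zero>\<^bsub>bsl_prod I S\<^esub> \<otimes>\<^bsub>bsl_prod I S\<^esub> x = \<zero>\<^bsub>bsl_prod I S\<^esub>"
      using x assms
      by (auto simp: bsl_prod_def fun_eq_iff PiE_iff bounded_semilattice.absorb_mult)
  next
    fix x y assume xy: "x \<in> carrier (bsl_prod I S)" "y \<in> carrier (bsl_prod I S)"
    show "x \<otimes>\<^bsub>bsl_prod I S\<^esub> y \<in> carrier (bsl_prod I S)"
      using xy by (auto simp: bsl_prod_def PiE_iff m monoid.m_closed)
    show "x \<otimes>\<^bsub>bsl_prod I S\<^esub> y = y \<otimes>\<^bsub>bsl_prod I S\<^esub> x"
      using xy by (auto simp: bsl_prod_def fun_eq_iff PiE_iff cm comm_monoid.m_comm)
  next
    fix x y z assume xyz: "x \<in> carrier (bsl_prod I S)" "y \<in> carrier (bsl_prod I S)"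
      "z \<in> carrier (bsl_prod I S)"
    show "x \<otimes>\<^bsub>bsl_prod I S\<^esub> y \<otimes>\<^bsub>bsl_prod I S\<^esub> z = x \<otimes>\<^bsub>bsl_prod I S\<^esub> (y \<otimes>\<^bsub>bsl_prod I S\<^esub> z)"
      using xyz by (auto simp: bsl_prod_def fun_eq_iff PiE_iff m monoid.m_assoc)
  next
    show "\<one>\<^bsub>bsl_prod I S\<^esub> \<in> carrier (bsl_prod I S)"
      by (auto simp: bsl_prod_def m monoid.one_closed)
    show "\<zero>\<^bsub>bsl_prod I S\<^esub> \<in> carrier (bsl_prod I S)"
      using assms by (auto simp: bsl_prod_def bounded_semilattice.absorb_closed)
  qed
qed


section \<open>Length of a poset\<close>

text \<open>The empty chain is left out of the supremum: on a nonempty poset it does not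
  contribute, and natural-number subtraction would misrepresent its value.\<close>

definition poset_length :: "('a \<Rightarrow> 'a \<Rightarrow> bool) \<Rightarrow> 'a set \<Rightarrow> enat" where
  "poset_length r P =
    (SUP C \<in> {C. C \<subseteq> P \<and> C \<noteq> {} \<and> Complete_Partial_Order.chain r C}.
      if finite C then enat (card C - 1) else \<infinity>)"

definition bsl_length :: "('a, 'b) bsl_scheme \<Rightarrow> enat" where
  "bsl_length S = poset_length (sl_le S) (carrier S)"

lemma bsl_length_finite_chain:
  assumes "finite (carrier S)" "carrier S \<noteq> {}" "is_chain S"
  shows "bsl_length S = enat (card (carrier S) - 1)"
proof -
  let ?A = "{C. C \<subseteq> carrier S \<and> C \<noteq> {} \<and> Complete_Partial_Order.chain (sl_le S) C}"
  let ?f = "\<lambda>C. if finite C then enat (card C - 1) else \<infinity>"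
  have "?f C \<le> enat (card (carrier S) - 1)" if "C \<in> ?A" for C
    using assms(1) that by (auto dest: finite_subset intro: diff_le_mono card_mono)
  then have "(SUP C\<in>?A. ?f C) \<le> enat (card (carrier S) - 1)"
    by (rule SUP_least)
  moreover have "carrier S \<in> ?A"
    using assms by (simp add: is_chain_def)
  then have "?f (carrier S) \<le> (SUP C\<in>?A. ?f C)"
    by (rule SUP_upper)
  ultimately show ?thesis
    using assms(1) by (simp add: bsl_length_def poset_length_def)
qed


section \<open>Graphs\<close>

text \<open>As usual in the graph library, a simple undirected graph is a symmetric, loop-free
  digraph without parallel arcs. Each undirected edge is therefore a pair of
  opposite arcs, and an Eulerian closed walk has to use exactly one of the two, once.
  (The library's Euler trails are directed: they would use both.)\<close>

definition bsl_graph :: "('a, 'b) bsl_scheme \<Rightarrow> 'a pair_pre_digraph" where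
  "bsl_graph S =
    (let V = carrier S - {\<zero>\<^bsub>S\<^esub>, \<one>\<^bsub>S\<^esub>} in
      \<lparr> pverts = V,
        parcs = {(x, y). x \<in> V \<and> y \<in> V \<and> x \<noteq> y \<and> x \<otimes>\<^bsub>S\<^esub> y \<noteq> \<zero>\<^bsub>S\<^esub>} \<rparr>)"

lemma pair_bidirected_bsl_graph:
  assumes "bounded_semilattice S"
  shows "pair_bidirected_digraph (bsl_graph S)"
proof -
  have "Group.comm_monoid S"
    using assms by (simp add: bounded_semilattice_def)
  then show ?thesis
    by unfold_locales
      (auto simp: bsl_graph_def Let_def symmetric_def sym_def comm_monoid.m_comm)
qed

definition undirected :: "'a \<times> 'a \<Rightarrow> 'a set" where
  "undirected a = {fst a, snd a}"

definition eulerian :: "'a pair_pre_digraph \<Rightarrow> bool" where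
  "eulerian G \<longleftrightarrow>
    connected (with_proj G) \<and>
    (\<exists>p. vwalk p (with_proj G) \<and> hd p = last p \<and>
      distinct (map undirected (vwalk_arcs p)) \<and>
      undirected ` set (vwalk_arcs p) = undirected ` parcs G)"

end

theory Submission
  imports Defs
begin

text \<open>
  By Euler's theorem the graph is Eulerian iff it is connected and all its degrees are even.
  In a chain a product vanishes only if a factor does, so two distinct vertices of the product
  are adjacent iff their supports meet. Hence a vertex \<open>x\<close> has degree
  \<open>(\<Prod>i. k i) - (\<Prod>i | x i = 0. k i) - 2\<close>, where \<open>k i\<close> is the number of elements of the \<open>i\<close>-th chain;
  the subtracted \<open>2\<close> stands for \<open>x\<close> and \<open>1\<close>. These numbers are even if all \<open>k i\<close> are odd or all are
  \<open>2\<close>. If some \<open>k i\<close> is even and not all of them are \<open>2\<close>, then a vertex of full support exists and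
  has odd degree. With three factors, two vertices with disjoint supports have a common neighbour.
\<close>

section \<open>Euler's theorem\<close>

lemma undirected_eq_iff:
  "undirected (a, b) = undirected (c, d) \<longleftrightarrow> a = c \<and> b = d \<or> a = d \<and> b = c"
  by (auto simp: undirected_def doubleton_eq_iff)

lemma undirected_commute: "undirected (a, b) = undirected (b, a)"
  by (auto simp: undirected_def)

text \<open>Prefixing an arc with distinct ends toggles the parity at exactly these two ends, so the
  odd count moves from the old head to the new one. Repeated edges are counted with
  multiplicity.\<close>

lemma odd_vwalk_incidences_iff:
  assumes "p \<noteq> []" and "\<And>a. a \<in> set (vwalk_arcs p) \<Longrightarrow> fst a \<noteq> snd a"
  shows "odd (length (filter ((\<in>) v) (map undirected (vwalk_arcs p)))) \<longleftrightarrow>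
    (v = hd p) \<noteq> (v = last p)"
  using assms
proof (induction p rule: vwalk_arcs.induct)
  case (3 x y xs)
  have "x \<noteq> y"
    using "3.prems"(2)[of "(x, y)"] by simp
  moreover have "odd (length (filter ((\<in>) v) (map undirected (vwalk_arcs (y # xs))))) \<longleftrightarrow>
      (v = y) \<noteq> (v = last (y # xs))"
    using "3.IH" "3.prems"(2) by simp
  ultimately show ?case
    by (auto simp: undirected_def[of "(x, y)"])
qed auto

lemma vwalk_arcs_append_overlap:
  "vwalk_arcs (xs @ v # ys) = vwalk_arcs (xs @ [v]) @ vwalk_arcs (v # ys)"
proof (induction xs rule: vwalk_arcs.induct)
  case (2 x)
  then show ?case by (cases ys) auto
qed auto

lemma undirected_vwalk_arcs_subset:
  assumes "a \<in> set (vwalk_arcs p)"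
  shows "undirected a \<subseteq> set p"
  using assms
proof (induction p rule: vwalk_arcs.induct)
  case (3 x y xs)
  then have "a = (x, y) \<or> undirected a \<subseteq> set (y # xs)"
    by auto
  then show ?case
    by (elim disjE) (simp_all add: undirected_def)
qed simp_all

section \<open>Trails in a finite symmetric loop-free graph\<close>

context pair_graph
begin

text \<open>Distinctness is imposed on the \<open>undirected\<close> images, so an edge cannot be
  used once in each direction.\<close>

definition edge_trail :: "'a list \<Rightarrow> bool" where
  "edge_trail p \<longleftrightarrow> vwalk p (with_proj G) \<and> distinct (map undirected (vwalk_arcs p))"

lemma edge_trailD:
  assumes "edge_trail p"
  shows "p \<noteq> []" "set p \<subseteq> pverts G" "set (vwalk_arcs p) \<subseteq> parcs G"
    "distinct (map undirected (vwalk_arcs p))"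
  using assms by (auto simp: edge_trail_def vwalk_def)

text \<open>By symmetry every edge at \<open>v\<close> comes from an arc leaving \<open>v\<close>,
  and from only one, since arcs with a common tail are told apart by their heads.\<close>

lemma out_degree_eq_card_undirected:
  "out_degree (with_proj G) v = card {e \<in> undirected ` parcs G. v \<in> e}"
proof -
  have "{e \<in> undirected ` parcs G. v \<in> e} = undirected ` {a \<in> parcs G. fst a = v}"
  proof (intro equalityI subsetI)
    fix e assume "e \<in> {e \<in> undirected ` parcs G. v \<in> e}"
    then obtain a b where ab: "(a, b) \<in> parcs G" "e = undirected (a, b)" "v = a \<or> v = b"
      by (auto simp: undirected_def)
    have ba: "e = undirected (b, a)" "(b, a) \<in> parcs G"
      using ab undirected_commute arcs_symmetric by metis+
    from ab(3) show "e \<in> undirected ` {a \<in> parcs G. fst a = v}"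
    proof
      assume "v = a"
      then show ?thesis using ab by (intro image_eqI[of _ _ "(a, b)"]) auto
    next
      assume "v = b"
      then show ?thesis using ba by (intro image_eqI[of _ _ "(b, a)"]) auto
    qed
  qed (auto simp: undirected_def)
  moreover have "inj_on undirected {a \<in> parcs G. fst a = v}"
    by (auto simp: inj_on_def undirected_eq_iff)
  ultimately show ?thesis
    by (simp add: out_degree_def out_arcs_def card_image)
qed

lemma odd_trail_incidences_iff:
  assumes "edge_trail p"
  shows "odd (card {e \<in> undirected ` set (vwalk_arcs p). v \<in> e}) \<longleftrightarrow>
    (v = hd p) \<noteq> (v = last p)"
proof -
  have "length (filter ((\<in>) v) (map undirected (vwalk_arcs p))) =
      card {e \<in> undirected ` set (vwalk_arcs p). v \<in> e}"
    using edge_trailD(4)[OF assms] distinct_card[of "filter ((\<in>) v) (map undirected (vwalk_arcs p))"]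
    by simp
  moreover have "fst a \<noteq> snd a" if "a \<in> set (vwalk_arcs p)" for a
    using edge_trailD(3)[OF assms] that pair_no_loops by blast
  ultimately show ?thesis
    using odd_vwalk_incidences_iff[of p v] edge_trailD(1)[OF assms] by simp
qed

lemma edge_trail_Cons:
  assumes "edge_trail p" "(w, hd p) \<in> parcs G"
    and "undirected (w, hd p) \<notin> undirected ` set (vwalk_arcs p)"
  shows "edge_trail (w # p)"
  using assms vwalk_wf_digraph_consI[of p w] edge_trailD(1)[OF assms(1)]
  by (simp add: edge_trail_def)

text \<open>A closed trail can be started at any of its vertices; keeping the length lets a rotation
  of a longest trail be longest again.\<close>

lemma edge_trail_rotate:
  assumes "edge_trail p" "hd p = last p" "v \<in> set p"
  obtains q where "edge_trail q" "hd q = v" "set (vwalk_arcs q) = set (vwalk_arcs p)"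
    "length q = length p"
proof -
  obtain xs ys where p: "p = xs @ v # ys"
    using assms(3) by (auto simp: in_set_conv_decomp)
  show ?thesis
  proof (cases xs)
    case Nil
    then show ?thesis using that[of p] assms p by auto
  next
    case (Cons u us)
    \<comment> \<open>The final \<open>u\<close> of \<open>v # ys\<close> becomes the junction: the
      initial \<open>u\<close> of \<open>p\<close> is dropped and a closing \<open>v\<close> is
      appended, so the length stays the same.\<close>
    let ?q = "v # ys @ us @ [v]"
    have last: "last (v # ys) = u"
      using assms(2) p Cons by simp
    have arcs_p: "vwalk_arcs p = vwalk_arcs (xs @ [v]) @ vwalk_arcs (v # ys)"
      unfolding p by (rule vwalk_arcs_append_overlap)
    obtain zs where zs: "v # ys = zs @ [u]"
      using last by (metis append_butlast_last_id list.distinct(1))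
    have q: "?q = zs @ u # (us @ [v])"
      using zs by simp
    have arcs_q: "vwalk_arcs ?q = vwalk_arcs (v # ys) @ vwalk_arcs (xs @ [v])"
      unfolding q vwalk_arcs_append_overlap[of zs u "us @ [v]"] zs by (simp add: Cons)
    have "set ?q \<subseteq> pverts G"
      using edge_trailD(2)[OF assms(1)] by (auto simp: p Cons)
    then have "edge_trail ?q"
      using assms(1) unfolding edge_trail_def vwalk_def arcs_p arcs_q
      by (simp add: Int_commute)
    then show ?thesis
      using arcs_p arcs_q by (intro that[of ?q]) (auto simp: p Cons)
  qed
qed

text \<open>With symmetric arcs, connectedness gives a directed path from \<open>v\<close> to every
  vertex, and no such path leaves \<open>X\<close>.\<close>

lemma connected_closed_subset:
  assumes "connected (with_proj G)" "v \<in> X" "v \<in> pverts G"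
    and "\<And>a b. (a, b) \<in> parcs G \<Longrightarrow> a \<in> X \<Longrightarrow> b \<in> X"
  shows "pverts G \<subseteq> X"
proof
  fix w assume w: "w \<in> pverts G"
  have "strongly_connected (with_proj G)"
    using symmetric_connected_imp_strongly_connected[OF pair_sym_arcs assms(1)] .
  then have "v \<rightarrow>\<^sup>*\<^bsub>with_proj G\<^esub> w"
    using w assms(3) by (auto simp: strongly_connected_def)
  then show "w \<in> X"
    by (induction rule: reachable_induct) (use assms in auto)
qed

text \<open>Each edge is used at most once and a walk has one more vertex than arcs; this bound
  makes a longest trail exist.\<close>

lemma edge_trail_length:
  assumes "edge_trail p"
  shows "length p \<le> card (undirected ` parcs G) + 1"
proof -
  have "length (vwalk_arcs p) = card (undirected ` set (vwalk_arcs p))"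
    using distinct_card[OF edge_trailD(4)[OF assms]] by simp
  also have "\<dots> \<le> card (undirected ` parcs G)"
    using edge_trailD(3)[OF assms] pair_finite_arcs by (intro card_mono) auto
  finally show ?thesis
    using vwalk_length_simp[of p, unfolded vwalk_length_def] by simp
qed

text \<open>A closed trail through all edges meets every vertex an even number of times. Conversely,
  under even degrees a longest trail is closed and, by connectedness, uses every edge.\<close>

theorem eulerian_iff_even_degree:
  "eulerian G \<longleftrightarrow>
    connected (with_proj G) \<and> (\<forall>v\<in>pverts G. even (out_degree (with_proj G) v))"
proof (intro iffI conjI ballI)
  assume "eulerian G"
  then show "connected (with_proj G)"
    by (simp add: eulerian_def)
  fix v assume "v \<in> pverts G"
  obtain p where "edge_trail p" "hd p = last p"
    "undirected ` set (vwalk_arcs p) = undirected ` parcs G"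
    using \<open>eulerian G\<close> by (auto simp: eulerian_def edge_trail_def)
  then show "even (out_degree (with_proj G) v)"
    using odd_trail_incidences_iff[of p v] by (simp add: out_degree_eq_card_undirected)
next
  assume "connected (with_proj G) \<and> (\<forall>v\<in>pverts G. even (out_degree (with_proj G) v))"
  then have conn: "connected (with_proj G)"
    and even: "\<And>v. v \<in> pverts G \<Longrightarrow> even (out_degree (with_proj G) v)"
    by auto
  obtain v0 where "v0 \<in> pverts G"
    using conn by (auto simp: connected_conv)
  then have "edge_trail [v0]"
    by (auto simp: edge_trail_def)
  then obtain p where p: "edge_trail p" and max: "\<And>q. edge_trail q \<Longrightarrow> length q \<le> length p"
    using ex_has_greatest_nat[of edge_trail "[v0]" length "card (undirected ` parcs G) + 2"]
      edge_trail_length by (metis add_2_eq_Suc' less_Suc_eq_le Suc_eq_plus1)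
  let ?used = "\<lambda>q. undirected ` set (vwalk_arcs q)"
  \<comment> \<open>A longest trail cannot be prolonged at its head, so all edges there are used.
    This is stated for any \<open>q\<close> as long as \<open>p\<close>, to cover the rotations of
    \<open>p\<close>.\<close>
  have used: "undirected (a, b) \<in> ?used q"
    if "edge_trail q" "length q = length p" "hd q = a" "(a, b) \<in> parcs G" for q a b
  proof -
    have "\<not> edge_trail (b # q)"
      using max[of "b # q"] that(2) by auto
    then show ?thesis
      using edge_trail_Cons[of q b] that arcs_symmetric undirected_commute[of a b] by auto
  qed
  \<comment> \<open>An open trail meets its head an odd number of times; as it has used all edges
    there, the degree of the head would be odd.\<close>
  have closed: "hd p = last p"
  proof (rule ccontr)
    assume "hd p \<noteq> last p"
    then have "odd (card {e \<in> ?used p. hd p \<in> e})"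
      using odd_trail_incidences_iff[OF p] by simp
    moreover have "{e \<in> ?used p. hd p \<in> e} = {e \<in> undirected ` parcs G. hd p \<in> e}"
    proof -
      have "e \<in> ?used p" if "(a, b) \<in> parcs G" "hd p \<in> undirected (a, b)" "e = undirected (a, b)"
        for e a b
      proof -
        have "a = hd p \<or> b = hd p"
          using that(2) by (auto simp: undirected_def)
        then show ?thesis
          using used[OF p refl refl, of a] used[OF p refl refl, of b] that arcs_symmetric[of a b]
            undirected_commute[of a b]
          by auto
      qed
      then show ?thesis
        using edge_trailD(3)[OF p] by auto
    qed
    moreover have "hd p \<in> pverts G"
      using edge_trailD(1,2)[OF p] by auto
    ultimately show False
      using even by (simp add: out_degree_eq_card_undirected)
  qed
  \<comment> \<open>Rotating \<open>p\<close> to start at \<open>a\<close> extends the exhaustion of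
    edges from the head to every vertex of \<open>p\<close>.\<close>
  have used_at: "undirected (a, b) \<in> ?used p" if a: "a \<in> set p" and ab: "(a, b) \<in> parcs G" for a b
  proof -
    obtain q where "edge_trail q" "hd q = a" "set (vwalk_arcs q) = set (vwalk_arcs p)"
      "length q = length p"
      using edge_trail_rotate[OF p closed a] .
    then show ?thesis
      using used[of q a b] ab by simp
  qed
  have "pverts G \<subseteq> set p"
  proof (rule connected_closed_subset[OF conn])
    show "hd p \<in> set p" "hd p \<in> pverts G"
      using edge_trailD(1,2)[OF p] by auto
    show "b \<in> set p" if ab: "(a, b) \<in> parcs G" and a: "a \<in> set p" for a b
    proof -
      obtain c where "c \<in> set (vwalk_arcs p)" "undirected (a, b) = undirected c"
        using used_at[OF a ab] by blast
      then have "undirected (a, b) \<subseteq> set p"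
        using undirected_vwalk_arcs_subset by metis
      then show ?thesis
        by (simp add: undirected_def)
    qed
  qed
  then have "undirected ` parcs G \<subseteq> ?used p"
    using used_at wellformed' by (metis image_subsetI subrelI subset_iff surj_pair)
  then have "?used p = undirected ` parcs G"
    using edge_trailD(3)[OF p] by blast
  then show "eulerian G"
    using conn p closed by (auto simp: eulerian_def edge_trail_def)
qed

end


section \<open>Products of finite chains\<close>

text \<open>In a chain the product of two elements is the smaller one.\<close>

lemma (in bounded_semilattice) chain_mult_eq_absorb_iff:
  assumes "is_chain S" "x \<in> carrier S" "y \<in> carrier S"
  shows "x \<otimes> y = \<zero> \<longleftrightarrow> x = \<zero> \<or> y = \<zero>"
proof -
  have "x \<otimes> y = x \<or> x \<otimes> y = y"
    using assms chainD[of "sl_le S" "carrier S" x y] m_comm[of x y]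
    by (auto simp: is_chain_def sl_le_def)
  then show ?thesis
    using assms absorb_mult m_comm[of x \<zero>] absorb_closed by metis
qed

locale finite_chain_family =
  fixes I :: "'i set" and S :: "'i \<Rightarrow> ('a, 'b) bsl_scheme"
  assumes finite_index: "finite I"
    and bsl: "i \<in> I \<Longrightarrow> bounded_semilattice (S i)"
    and zero_neq_one: "i \<in> I \<Longrightarrow> \<zero>\<^bsub>S i\<^esub> \<noteq> \<one>\<^bsub>S i\<^esub>"
    and finite_carrier: "i \<in> I \<Longrightarrow> finite (carrier (S i))"
    and chain: "i \<in> I \<Longrightarrow> is_chain (S i)"
begin

abbreviation "P \<equiv> bsl_prod I S"
abbreviation "G \<equiv> bsl_graph P"

lemma zero_closed: "i \<in> I \<Longrightarrow> \<zero>\<^bsub>S i\<^esub> \<in> carrier (S i)"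
  using bsl bounded_semilattice.absorb_closed by blast

lemma one_closed: "i \<in> I \<Longrightarrow> \<one>\<^bsub>S i\<^esub> \<in> carrier (S i)"
  using bsl by (simp add: bounded_semilattice_def Group.comm_monoid_def monoid.one_closed)

lemma pverts_iff:
  "x \<in> pverts G \<longleftrightarrow> x \<in> (\<Pi>\<^sub>E i\<in>I. carrier (S i)) \<and>
    (\<exists>i\<in>I. x i \<noteq> \<zero>\<^bsub>S i\<^esub>) \<and> (\<exists>i\<in>I. x i \<noteq> \<one>\<^bsub>S i\<^esub>)"
  by (auto simp: bsl_graph_def Let_def bsl_prod_def fun_eq_iff PiE_iff extensional_def)

lemma parcs_iff:
  "(x, y) \<in> parcs G \<longleftrightarrow> x \<in> pverts G \<and> y \<in> pverts G \<and> x \<noteq> y \<and>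
    (\<exists>i\<in>I. x i \<noteq> \<zero>\<^bsub>S i\<^esub> \<and> y i \<noteq> \<zero>\<^bsub>S i\<^esub>)"
proof -
  have "x i \<otimes>\<^bsub>S i\<^esub> y i = \<zero>\<^bsub>S i\<^esub> \<longleftrightarrow> x i = \<zero>\<^bsub>S i\<^esub> \<or> y i = \<zero>\<^bsub>S i\<^esub>"
    if "i \<in> I" "x \<in> pverts G" "y \<in> pverts G" for i
    using that bounded_semilattice.chain_mult_eq_absorb_iff[OF bsl chain, of i "x i" "y i"]
    by (auto simp: pverts_iff PiE_iff)
  then have "x \<otimes>\<^bsub>P\<^esub> y \<noteq> \<zero>\<^bsub>P\<^esub> \<longleftrightarrow> (\<exists>i\<in>I. x i \<noteq> \<zero>\<^bsub>S i\<^esub> \<and> y i \<noteq> \<zero>\<^bsub>S i\<^esub>)"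
    if "x \<in> pverts G" "y \<in> pverts G"
    using that by (auto simp: bsl_prod_def fun_eq_iff)
  then show ?thesis
    by (auto simp: bsl_graph_def Let_def)
qed

lemma finite_pverts: "finite (pverts G)"
  using finite_PiE[OF finite_index, of "\<lambda>i. carrier (S i)"] finite_carrier
  by (rule_tac finite_subset[of _ "\<Pi>\<^sub>E i\<in>I. carrier (S i)"]) (auto simp: pverts_iff)

lemma pair_graph_G: "pair_graph G"
proof -
  have "bounded_semilattice P"
    using bsl by (rule bounded_semilattice_bsl_prod)
  then interpret pair_bidirected_digraph G
    by (rule pair_bidirected_bsl_graph)
  have "finite (parcs G)"
    using finite_subset[OF _ finite_cartesian_product[OF finite_pverts finite_pverts]] wellformed'
    by (metis SigmaI subrelI)
  then show ?thesis
    using finite_pverts by unfold_locales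
qed

section \<open>Degrees in the product graph\<close>

text \<open>The tuples whose support meets that of \<open>x\<close> are counted as all tuples minus
  those vanishing on the support of \<open>x\<close>. The additive form avoids truncated
  subtraction.\<close>

lemma out_degree_eq:
  assumes "x \<in> pverts G"
  shows "out_degree (with_proj G) x + 2 + (\<Prod>i | i \<in> I \<and> x i = \<zero>\<^bsub>S i\<^esub>. card (carrier (S i))) =
    (\<Prod>i\<in>I. card (carrier (S i)))"
proof -
  let ?C = "\<lambda>i. carrier (S i)"
  \<comment> \<open>The product of the \<open>?D i\<close> consists of the tuples whose support is
    disjoint from that of \<open>x\<close>, the zero tuple among them.\<close>
  let ?D = "\<lambda>i. if x i = \<zero>\<^bsub>S i\<^esub> then ?C i else {\<zero>\<^bsub>S i\<^esub>}"
  let ?N = "{y. (x, y) \<in> parcs G}" and ?one = "\<lambda>i\<in>I. \<one>\<^bsub>S i\<^esub>"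
  have fin: "finite (Pi\<^sub>E I ?C)"
    using finite_index finite_carrier by (rule finite_PiE)
  have sub: "Pi\<^sub>E I ?D \<subseteq> Pi\<^sub>E I ?C"
    using zero_closed by (intro PiE_mono) auto
  have meets: "y \<in> Pi\<^sub>E I ?C - Pi\<^sub>E I ?D \<longleftrightarrow>
      y \<in> Pi\<^sub>E I ?C \<and> (\<exists>i\<in>I. x i \<noteq> \<zero>\<^bsub>S i\<^esub> \<and> y i \<noteq> \<zero>\<^bsub>S i\<^esub>)" for y
    by (auto simp: PiE_iff split: if_splits)
  have eq_one: "y = ?one \<longleftrightarrow> (\<forall>i\<in>I. y i = \<one>\<^bsub>S i\<^esub>)" if "y \<in> Pi\<^sub>E I ?C" for y
    using that by (auto simp: fun_eq_iff PiE_iff extensional_def)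
  have x: "x \<in> Pi\<^sub>E I ?C" "\<exists>i\<in>I. x i \<noteq> \<zero>\<^bsub>S i\<^esub>" "x \<noteq> ?one"
    using assms eq_one by (auto simp: pverts_iff)
  have one: "?one \<in> Pi\<^sub>E I ?C"
    using one_closed by auto
  \<comment> \<open>Both \<open>x\<close> and \<open>?one\<close> meet the support of
    \<open>x\<close> without being neighbours: there are no loops, and \<open>?one\<close> is not a
    vertex. They account for the summand 2.\<close>
  have "y \<in> Pi\<^sub>E I ?C - Pi\<^sub>E I ?D \<longleftrightarrow> y \<in> ?N \<union> {x, ?one}" for y
  proof -
    have "?one \<in> Pi\<^sub>E I ?C - Pi\<^sub>E I ?D" "x \<in> Pi\<^sub>E I ?C - Pi\<^sub>E I ?D"
      unfolding meets using x one zero_neq_one by fastforce+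
    moreover have "y \<in> ?N \<longleftrightarrow> y \<in> Pi\<^sub>E I ?C - Pi\<^sub>E I ?D" if "y \<noteq> x" "y \<noteq> ?one"
      unfolding meets using assms that eq_one[of y] by (auto simp: parcs_iff pverts_iff)
    ultimately show ?thesis by blast
  qed
  then have split: "Pi\<^sub>E I ?C - Pi\<^sub>E I ?D = ?N \<union> {x, ?one}"
    by blast
  have "?N \<inter> {x, ?one} = {}"
    by (auto simp: parcs_iff pverts_iff)
  moreover have "finite ?N"
    using finite_subset[OF _ finite_pverts, of ?N] by (auto simp: parcs_iff)
  ultimately have "card (Pi\<^sub>E I ?C - Pi\<^sub>E I ?D) = card ?N + 2"
    unfolding split using x(3) by (subst card_Un_disjoint) auto
  moreover have "card ?N = out_degree (with_proj G) x"
    unfolding out_degree_def out_arcs_def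
    by (rule bij_betw_same_card[of "Pair x"]) (auto simp: bij_betw_def inj_on_def)
  moreover have "card (Pi\<^sub>E I ?D) = (\<Prod>i | i \<in> I \<and> x i = \<zero>\<^bsub>S i\<^esub>. card (?C i))"
  proof -
    have "card (Pi\<^sub>E I ?D) = (\<Prod>i\<in>I. if x i = \<zero>\<^bsub>S i\<^esub> then card (?C i) else 1)"
      using finite_index by (subst card_PiE) (auto intro: prod.cong)
    then show ?thesis
      using finite_index prod.inter_filter[of I "\<lambda>i. card (?C i)" "\<lambda>i. x i = \<zero>\<^bsub>S i\<^esub>"] by simp
  qed
  moreover have "card (Pi\<^sub>E I ?C - Pi\<^sub>E I ?D) + card (Pi\<^sub>E I ?D) = card (Pi\<^sub>E I ?C)"
    using fin sub by (simp add: card_Diff_subset card_mono finite_subset)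
  ultimately show ?thesis
    using finite_index by (simp add: card_PiE)
qed

text \<open>Modulo 2 the degree is the sum of the two products, and a product is even iff some
  factor is.\<close>

lemma even_out_degree_iff:
  assumes "x \<in> pverts G"
  shows "even (out_degree (with_proj G) x) \<longleftrightarrow>
    ((\<exists>i\<in>I. x i = \<zero>\<^bsub>S i\<^esub> \<and> even (card (carrier (S i)))) \<longleftrightarrow>
      (\<exists>i\<in>I. even (card (carrier (S i)))))"
proof -
  have "even (out_degree (with_proj G) x) \<longleftrightarrow>
      (even (\<Prod>i | i \<in> I \<and> x i = \<zero>\<^bsub>S i\<^esub>. card (carrier (S i))) \<longleftrightarrow>
        even (\<Prod>i\<in>I. card (carrier (S i))))"
    using arg_cong[where f = even, OF out_degree_eq[OF assms]] by auto
  then show ?thesis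
    using finite_index by (simp add: even_prod_iff conj_ac Bex_def)
qed

lemma all_out_degrees_even_iff:
  assumes "I \<noteq> {}"
  shows "(\<forall>x\<in>pverts G. even (out_degree (with_proj G) x)) \<longleftrightarrow>
    (\<forall>i\<in>I. odd (card (carrier (S i)))) \<or> (\<forall>i\<in>I. card (carrier (S i)) = 2)"
proof (intro iffI ballI)
  assume even: "\<forall>x\<in>pverts G. even (out_degree (with_proj G) x)"
  show "(\<forall>i\<in>I. odd (card (carrier (S i)))) \<or> (\<forall>i\<in>I. card (carrier (S i)) = 2)"
  proof (rule ccontr)
    assume "\<not> ?thesis"
    then obtain i j where i: "i \<in> I" "even (card (carrier (S i)))"
      and j: "j \<in> I" "card (carrier (S j)) \<noteq> 2"
      by blast
    \<comment> \<open>An element other than 0 and 1 allows a tuple of full support to differ from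
      the top.\<close>
    have "\<not> carrier (S j) \<subseteq> {\<zero>\<^bsub>S j\<^esub>, \<one>\<^bsub>S j\<^esub>}"
    proof
      assume "carrier (S j) \<subseteq> {\<zero>\<^bsub>S j\<^esub>, \<one>\<^bsub>S j\<^esub>}"
      then have "carrier (S j) = {\<zero>\<^bsub>S j\<^esub>, \<one>\<^bsub>S j\<^esub>}"
        using zero_closed one_closed j by blast
      then show False
        using j zero_neq_one by simp
    qed
    then obtain a where a: "a \<in> carrier (S j)" "a \<noteq> \<zero>\<^bsub>S j\<^esub>" "a \<noteq> \<one>\<^bsub>S j\<^esub>"
      by blast
    define x where "x = (\<lambda>k\<in>I. if k = j then a else \<one>\<^bsub>S k\<^esub>)"
    have nz: "x k \<noteq> \<zero>\<^bsub>S k\<^esub>" if "k \<in> I" for k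
      using that a zero_neq_one[OF that] by (auto simp: x_def)
    have "x \<in> pverts G"
      unfolding pverts_iff using nz j a one_closed by (auto simp: x_def)
    \<comment> \<open>Full support makes the left side of the parity criterion false, while
      \<open>i\<close> makes its right side true.\<close>
    then show False
      using even even_out_degree_iff nz i by blast
  qed
next
  fix x assume x: "x \<in> pverts G"
  assume "(\<forall>i\<in>I. odd (card (carrier (S i)))) \<or> (\<forall>i\<in>I. card (carrier (S i)) = 2)"
  then show "even (out_degree (with_proj G) x)"
  proof
    assume "\<forall>i\<in>I. odd (card (carrier (S i)))"
    then show ?thesis
      by (simp add: even_out_degree_iff[OF x])
  next
    assume two: "\<forall>i\<in>I. card (carrier (S i)) = 2"
    obtain i where i: "i \<in> I" "x i \<noteq> \<one>\<^bsub>S i\<^esub>" "x i \<in> carrier (S i)"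
      using x by (auto simp: pverts_iff)
    \<comment> \<open>With two elements in each factor, a coordinate different from 1 is 0, so both
      sides of the parity criterion hold.\<close>
    have "carrier (S i) = {\<zero>\<^bsub>S i\<^esub>, \<one>\<^bsub>S i\<^esub>}"
      using two i zero_closed one_closed zero_neq_one finite_carrier
      by (intro card_seteq[symmetric]) auto
    then have "x i = \<zero>\<^bsub>S i\<^esub>"
      using i by auto
    then show ?thesis
      using two i(1) by (auto simp: even_out_degree_iff[OF x])
  qed
qed

section \<open>Connectedness through a common neighbour\<close>

lemma connected_G:
  assumes "card I \<ge> 3"
  shows "connected (with_proj G)"
proof -
  interpret pair_graph G
    by (rule pair_graph_G)
  \<comment> \<open>For \<open>i\<close> and \<open>j\<close> in the supports of \<open>x\<close>
    and \<open>y\<close>, the 0-1 tuple \<open>ind {i, j}\<close> meets both supports and links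
    \<open>x\<close> to \<open>y\<close>.\<close>
  define ind where "ind J = (\<lambda>i\<in>I. if i \<in> J then \<one>\<^bsub>S i\<^esub> else \<zero>\<^bsub>S i\<^esub>)" for J
  have ind_nz: "ind J i \<noteq> \<zero>\<^bsub>S i\<^esub>" if "i \<in> J" "i \<in> I" for i J
    using that zero_neq_one[of i] by (auto simp: ind_def)
  have ind: "ind {i, j} \<in> pverts G" if "i \<in> I" "j \<in> I" for i j
  proof -
    \<comment> \<open>A third index is what keeps \<open>ind {i, j}\<close> from being the top
      element, which is not a vertex.\<close>
    have "\<not> I \<subseteq> {i, j}"
    proof
      assume "I \<subseteq> {i, j}"
      then have "card I \<le> card {i, j}"
        by (intro card_mono) auto
      also have "\<dots> \<le> 2"
        by (simp add: card_insert_if)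
      finally show False
        using assms by simp
    qed
    then obtain k where k: "k \<in> I" "k \<noteq> i" "k \<noteq> j"
      by blast
    then have "ind {i, j} k \<noteq> \<one>\<^bsub>S k\<^esub>"
      using zero_neq_one by (auto simp: ind_def)
    moreover have "ind {i, j} i \<noteq> \<zero>\<^bsub>S i\<^esub>"
      using that ind_nz by simp
    moreover have "ind {i, j} \<in> (\<Pi>\<^sub>E i\<in>I. carrier (S i))"
      using zero_closed one_closed by (auto simp: ind_def)
    ultimately show ?thesis
      unfolding pverts_iff using that k by blast
  qed
  have step: "x \<rightarrow>\<^sup>*\<^bsub>with_proj G\<^esub> y"
    if "x \<in> pverts G" "y \<in> pverts G" "i \<in> I" "x i \<noteq> \<zero>\<^bsub>S i\<^esub>" "y i \<noteq> \<zero>\<^bsub>S i\<^esub>" for x y i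
  proof (cases "x = y")
    case True
    then show ?thesis
      using that by auto
  next
    case False
    then have "(x, y) \<in> parcs G"
      using that by (auto simp: parcs_iff)
    then show ?thesis
      by (intro reachable_adjI) simp
  qed
  have "strongly_connected (with_proj G)"
  proof (rule strongly_connectedI)
    have "I \<noteq> {}"
      using assms by auto
    then show "verts (with_proj G) \<noteq> {}"
      using ind by auto
    fix x y assume "x \<in> verts (with_proj G)" "y \<in> verts (with_proj G)"
    then have xy: "x \<in> pverts G" "y \<in> pverts G"
      by simp_all
    then obtain i j where ij: "i \<in> I" "x i \<noteq> \<zero>\<^bsub>S i\<^esub>" "j \<in> I" "y j \<noteq> \<zero>\<^bsub>S j\<^esub>"
      by (auto simp: pverts_iff)
    have "x \<rightarrow>\<^sup>*\<^bsub>with_proj G\<^esub> ind {i, j}" "ind {i, j} \<rightarrow>\<^sup>*\<^bsub>with_proj G\<^esub> y"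
      using step[OF xy(1) ind, of i j i] step[OF ind xy(2), of i j j] ij ind_nz by auto
    then show "x \<rightarrow>\<^sup>*\<^bsub>with_proj G\<^esub> y"
      by (rule reachable_trans)
  qed
  \<comment> \<open>Connectedness means strong connectedness of the symmetric closure, and symmetric
    arcs have the same reachability as their closure.\<close>
  then show ?thesis
    using reachable_mk_symmetric_eq[OF pair_sym_arcs]
    by (simp add: connected_def strongly_connected_def)
qed

section \<open>From chain sizes to chain lengths\<close>

theorem eulerian_iff_card:
  assumes "card I \<ge> 3"
  shows "eulerian G \<longleftrightarrow>
    (\<forall>i\<in>I. odd (card (carrier (S i)))) \<or> (\<forall>i\<in>I. card (carrier (S i)) = 2)"
proof -
  have "I \<noteq> {}"
    using assms by auto
  then show ?thesis
    using connected_G[OF assms]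
    by (simp add: pair_graph.eulerian_iff_even_degree[OF pair_graph_G] all_out_degrees_even_iff)
qed

text \<open>A finite chain of \<open>k\<close> elements has length \<open>k - 1\<close>, which
  reverses parity.\<close>

lemma even_bsl_length_iff:
  assumes "i \<in> I"
  shows "2 dvd bsl_length (S i) \<longleftrightarrow> odd (card (carrier (S i)))"
proof -
  have ne: "carrier (S i) \<noteq> {}"
    using zero_closed[OF assms] by blast
  have "2 dvd enat m \<longleftrightarrow> even m" for m
  proof
    assume "2 dvd enat m"
    then obtain c where c: "enat m = 2 * c"
      by (auto simp: dvd_def)
    \<comment> \<open>The cofactor ranges over \<open>enat\<close>; an infinite one would make
      \<open>2 * c\<close> infinite.\<close>
    then show "even m"
      by (cases c) (auto simp: numeral_eq_enat)
  next
    assume "even m"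
    then obtain c where "m = 2 * c"
      by (auto simp: dvd_def)
    then have "enat m = 2 * enat c"
      by (simp add: numeral_eq_enat)
    then show "2 dvd enat m"
      by (rule dvdI)
  qed
  \<comment> \<open>Positivity is essential here: at 0 the truncated \<open>k - 1\<close> would not
    change the parity.\<close>
  moreover have "card (carrier (S i)) > 0"
    using ne finite_carrier[OF assms] by (simp add: card_gt_0_iff)
  ultimately show ?thesis
    using bsl_length_finite_chain[OF finite_carrier[OF assms] ne chain[OF assms]]
    by simp
qed

end

theorem theorem2p18:
  fixes n :: nat and S :: "nat \<Rightarrow> 'a bsl"
  assumes "n \<ge> 3"
    and "\<And>i. i \<in> {1..n} \<Longrightarrow> bounded_semilattice (S i)"
    and "\<And>i. i \<in> {1..n} \<Longrightarrow> \<zero>\<^bsub>S i\<^esub> \<noteq> \<one>\<^bsub>S i\<^esub>"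
    and "\<And>i. i \<in> {1..n} \<Longrightarrow> finite (carrier (S i))"
    and "\<And>i. i \<in> {1..n} \<Longrightarrow> is_chain (S i)"
  shows "eulerian (bsl_graph (bsl_prod {1..n} S)) \<longleftrightarrow>
    (\<forall>i\<in>{1..n}. 2 dvd bsl_length (S i)) \<or> (\<forall>i\<in>{1..n}. card (carrier (S i)) = 2)"
proof -
  interpret finite_chain_family "{1..n}" S
    using assms by (intro finite_chain_family.intro) auto
  show ?thesis
    using eulerian_iff_card even_bsl_length_iff assms(1) by simp
qed

end
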